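(* In every partition exchange economy with pairwise exchanges and compatibility graph $\mathcal G$, the $\nu(\mathcal G)$-supplemented core is nonempty; more precisely, there exist a set $V^0$ of at most $\nu(\mathcal G)$ additional altruistic donors (with suitably chosen edges) and a matching of $\mathcal G^{+V^0}$ that is in the $V^0$-supplemented core and is Pareto optimal in $\mathcal G^{+V^0}$. In particular, if $\mathcal G$ is bipartite, the (weak) core is nonempty and contains a Pareto-optimal matching.
   Context: Pairwise partition exchange economy: organizations $N=\{1,\dots,n\}$; pairwise disjoint finite sets $V^1,\dots,V^n$, $V=\bigcup_iV^i$; subsets $U^i\subseteq V^i$ (patient vertices of organization $i$); an undirected (mutual) compatibility graph $\mathcal G=(V,E)$. An exchange among $W\subseteq V$ is a matching of $\mathcal G[W]$; $u_i(M)$ is the number of vertices of $U^i$ covered by the matching $M$. Given a finite set $V^0$ of new vertices (additional altruistic donors, in no organization), $\mathcal G^{+V^0}$ adds these vertices, each joined by edges to an arbitrarily chosen set of vertices of $V$; exchanges in $\mathcal G^{+V^0}$ are its matchings. A nonempty coalition $P\subseteq N$ blocks a matching $M$ if some matching $M'$ of $\mathcal G[\bigcup_{i\in P}V^i]$ has $u_i(M')>u_i(M)$ for all $i\in P$. A matching of $\mathcal G^{+V^0}$ blocked by no coalition is in the $V^0$-supplemented core; with $V^0=\emptyset$ this is the (weak) core. The $d$-supplemented core is nonempty if for some $V^0$ with $|V^0|\le d$ and some choice of its edges the $V^0$-supplemented core is nonempty. A matching $M$ of $\mathcal G^{+V^0}$ is Pareto optimal if no matching $M'$ of $\mathcal G^{+V^0}$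 satisfies $u_i(M')\ge u_i(M)$ for all $i\in N$ with strict inequality for some $i$. A set of odd cycles $\{c_1,\dots,c_l\}$ of an undirected graph is independent if the cycles are pairwise vertex-disjoint and no edge joins a vertex of $c_i$ to a vertex of $c_j$ for $i\ne j$; $\nu(\mathcal G)$ is the maximum size of an independent set of odd cycles of $\mathcal G$. *)

theory Defs
  imports Main
begin

text \<open>Undirected graphs are given by a set E of 2-element vertex sets.
  A matching of G[W] is a set of pairwise disjoint edges of E contained in W.\<close>

definition is_matching :: "'a set set \<Rightarrow> 'a set \<Rightarrow> 'a set set \<Rightarrow> bool" where
  "is_matching E W M \<longleftrightarrow> M \<subseteq> E \<and> (\<forall>e\<in>M. e \<subseteq> W) \<and>
     (\<forall>e\<in>M. \<forall>f\<in>M. e \<noteq> f \<longrightarrow> e \<inter> f = {})"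

text \<open>u_i(M): number of patient vertices of U covered by M.\<close>
definition util :: "'a set \<Rightarrow> 'a set set \<Rightarrow> nat" where
  "util U M = card {v\<in>U. \<exists>e\<in>M. v \<in> e}"

definition blocks :: "'i set \<Rightarrow> ('i \<Rightarrow> 'a set) \<Rightarrow> ('i \<Rightarrow> 'a set) \<Rightarrow> 'a set set
    \<Rightarrow> 'i set \<Rightarrow> 'a set set \<Rightarrow> bool" where
  "blocks N Vs Us E P M \<longleftrightarrow> P \<noteq> {} \<and> P \<subseteq> N \<and>
     (\<exists>M'. is_matching E (\<Union>i\<in>P. Vs i) M' \<and> (\<forall>i\<in>P. util (Us i) M' > util (Us i) M))"

definition in_core :: "'i set \<Rightarrow> ('i \<Rightarrow> 'a set) \<Rightarrow> ('i \<Rightarrow> 'a set) \<Rightarrow> 'a set set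
    \<Rightarrow> 'a set \<Rightarrow> 'a set set \<Rightarrow> bool" where
  "in_core N Vs Us E W M \<longleftrightarrow> is_matching E W M \<and> (\<forall>P. \<not> blocks N Vs Us E P M)"

definition pareto_optimal :: "'i set \<Rightarrow> ('i \<Rightarrow> 'a set) \<Rightarrow> 'a set set
    \<Rightarrow> 'a set \<Rightarrow> 'a set set \<Rightarrow> bool" where
  "pareto_optimal N Us E W M \<longleftrightarrow> is_matching E W M \<and>
     \<not> (\<exists>M'. is_matching E W M' \<and> (\<forall>i\<in>N. util (Us i) M' \<ge> util (Us i) M) \<and>
            (\<exists>i\<in>N. util (Us i) M' > util (Us i) M))"

definition odd_cycle :: "'a set set \<Rightarrow> 'a list \<Rightarrow> bool" where
  "odd_cycle E c \<longleftrightarrow> distinct c \<and> length c \<ge> 3 \<and> odd (length c) \<and>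
     (\<forall>i<length c. {c ! i, c ! ((i + 1) mod length c)} \<in> E)"

definition indep_odd_cycles :: "'a set set \<Rightarrow> 'a list set \<Rightarrow> bool" where
  "indep_odd_cycles E C \<longleftrightarrow> finite C \<and> (\<forall>c\<in>C. odd_cycle E c) \<and>
     (\<forall>c\<in>C. \<forall>c'\<in>C. c \<noteq> c' \<longrightarrow> set c \<inter> set c' = {} \<and>
        (\<forall>x\<in>set c. \<forall>y\<in>set c'. {x, y} \<notin> E))"

definition nu :: "'a set set \<Rightarrow> nat" where
  "nu E = Max {card C | C. indep_odd_cycles E C}"

definition bipartite :: "'a set set \<Rightarrow> bool" where
  "bipartite E \<longleftrightarrow> (\<exists>X. \<forall>e\<in>E. \<exists>x y. e = {x, y} \<and> x \<in> X \<and> y \<notin> X)"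

text \<open>G^{+V0}: original vertices Inl v, new donors Inr j for j < d; donor j is joined
  to the vertices in A j.\<close>
definition aug_vertices :: "'v set \<Rightarrow> nat \<Rightarrow> ('v + nat) set" where
  "aug_vertices V d = Inl ` V \<union> Inr ` {..<d}"

definition aug_edges :: "'v set set \<Rightarrow> nat \<Rightarrow> (nat \<Rightarrow> 'v set) \<Rightarrow> ('v + nat) set set" where
  "aug_edges E d A = (\<lambda>e. Inl ` e) ` E \<union> {{Inr j, Inl v} | j v. j < d \<and> v \<in> A j}"

end

theory Submission
  imports Defs "HOL-Analysis.Brouwer_Fixpoint"
begin

text \<open>
  First, Kuhn's lemma on labellings of a grid yields integral utilities u that no coalition can
  improve upon and that are approximately balanced: push a grid point up along a coalition able to
  reach it and down along all of N if there is none; an approximate zero of this field is a family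
  of coalitions, each able to guarantee u to its members, that covers every organization almost
  equally often. Averaging the matchings of these coalitions gives an almost fractional matching
  with utilities u, so Hall's condition holds by integrality, and there is an injection from a
  set S of patients, |S \<inter> Us i| \<ge> u i, to compatible vertices. Its functional graph
  covers S by a matching and disjoint odd cycles. Two odd cycles joined by an edge can be replaced
  by a matching, hence the remaining ones may be taken independent, and one donor for each of them
  completes the matching. A matching maximizing the total utility among those with utilities at
  least u is then in the core and Pareto optimal.
\<close>

section \<open>Approximately balanced utilities\<close>

lemma card_div_shift_le_1:
  fixes a b p :: nat
  assumes "a \<le> b" "b \<le> a + 1"
  shows "card {t \<in> {..<p}. (a + t) div p \<noteq> (b + t) div p} \<le> 1"
proof (cases "b = a")
  case False
  then have b: "b = Suc a" using assms by simp
  have *: "Suc (a + t) mod p = 0" if "(a + t) div p \<noteq> (b + t) div p" for t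
    using that by (auto simp: b div_Suc split: if_splits)
  have "t = t'" if "t < p" "t' < p" "Suc (a + t) mod p = 0" "Suc (a + t') mod p = 0" "t \<le> t'" for t t'
  proof -
    have "p dvd Suc (a + t') - Suc (a + t)"
      using that by (intro dvd_diff_nat) auto
    then have "p dvd t' - t" using that by simp
    then show ?thesis using that by (auto dest!: dvd_imp_le)
  qed
  then have uniq: "t = t'" if "t < p" "t' < p" "Suc (a + t) mod p = 0" "Suc (a + t') mod p = 0" for t t'
    using that by (metis nat_le_linear)
  have "\<forall>t\<in>{t \<in> {..<p}. (a + t) div p \<noteq> (b + t) div p}.
      \<forall>t'\<in>{t \<in> {..<p}. (a + t) div p \<noteq> (b + t) div p}. t = t'"
  proof (intro ballI)
    fix t t' assume "t \<in> {t \<in> {..<p}. (a + t) div p \<noteq> (b + t) div p}"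
      "t' \<in> {t \<in> {..<p}. (a + t) div p \<noteq> (b + t) div p}"
    then show "t = t'" using uniq[OF _ _ * *, of t t'] by simp
  qed
  then show ?thesis
    unfolding One_nat_def by (rule card_le_Suc0_iff_eq[THEN iffD2, rotated]) simp
qed simp

lemma approximate_balance:
  fixes N :: "'i set" and \<beta> :: "('i \<Rightarrow> nat) \<Rightarrow> 'i set"
  assumes fin: "finite N" and K: "K > 0" and p: "p > 0"
    and cong: "\<And>w w'. (\<forall>i\<in>N. w i = w' i) \<Longrightarrow> \<beta> w = \<beta> w'"
    and low: "\<And>w i. i \<in> N \<Longrightarrow> w i = 0 \<Longrightarrow> i \<in> \<beta> w"
    and high: "\<And>w i. i \<in> N \<Longrightarrow> w i = K \<Longrightarrow> i \<notin> \<beta> w"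
  obtains q :: "'i \<Rightarrow> nat" where
    "\<And>i. i \<in> N \<Longrightarrow> \<bar>int (card {t \<in> {..<p}. i \<in> \<beta> (\<lambda>j. (q j + t) div p)})
        - int (card {t \<in> {..<p}. \<beta> (\<lambda>j. (q j + t) div p) = {}})\<bar> \<le> 2 * int (card N)"
proof -
  define n where "n = card N"
  obtain h where h: "bij_betw h {..<n} N"
    using ex_bij_betw_nat_finite[OF fin] unfolding n_def atLeast0LessThan by blast
  define e where "e = inv_into {..<n} h"
  have e: "e i < n" "h (e i) = i" if "i \<in> N" for i
    using that h unfolding e_def
    by (metis bij_betw_imp_surj_on inv_into_into lessThan_iff)
       (metis that h bij_betw_inv_into_right e_def)
  have h_N: "h k \<in> N" and eh: "e (h k) = k" if "k < n" for k
    using that h unfolding e_def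
    by (auto simp: bij_betw_def intro!: inv_into_f_f)
  define W where "W x t = (\<lambda>j. (x (e j) + t) div p)" for x :: "nat \<Rightarrow> nat" and t
  define \<tau> :: "'i \<Rightarrow> ('i \<Rightarrow> nat) \<Rightarrow> int" where
    "\<tau> i w = of_bool (i \<in> \<beta> w) - of_bool (\<beta> w = {})" for i w
  define g where "g i x = (\<Sum>t<p. \<tau> i (W x t))" for i x
  define lab :: "(nat \<Rightarrow> nat) \<Rightarrow> nat \<Rightarrow> nat" where
    "lab x k = (if x k = 0 then 0 else if x k = K * p then 1
       else if g (h k) x \<ge> 0 then 0 else 1)" for x k
  have lab0: "g (h k) x \<ge> 0" if "lab x k = 0" "k < n" for x k
  proof (cases "x k = 0")
    case True
    have "\<tau> (h k) (W x t) \<ge> 0" if "t < p" for t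
    proof -
      have "W x t (h k) = 0" using True that \<open>k < n\<close> by (simp add: W_def eh)
      then have "h k \<in> \<beta> (W x t)" using low h_N \<open>k < n\<close> by blast
      then show ?thesis by (auto simp: \<tau>_def)
    qed
    then show ?thesis unfolding g_def by (intro sum_nonneg) auto
  next
    case False
    then show ?thesis using that by (auto simp: lab_def split: if_splits)
  qed
  have lab1: "g (h k) x \<le> 0" if "lab x k = 1" "k < n" for x k
  proof (cases "x k = K * p")
    case True
    have "\<tau> (h k) (W x t) \<le> 0" if "t < p" for t
    proof -
      have "W x t (h k) = K" using True that \<open>k < n\<close> p by (simp add: W_def eh)
      then have "h k \<notin> \<beta> (W x t)" using high h_N \<open>k < n\<close> by blast
      then show ?thesis by (auto simp: \<tau>_def)
    qed
    then show ?thesis unfolding g_def by (intro sum_nonpos) auto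
  next
    case False
    then show ?thesis using that by (auto simp: lab_def split: if_splits)
  qed
  have near: "\<bar>g i x - g i y\<bar> \<le> 2 * int n"
    if xy: "\<forall>k<n. x k \<le> y k \<and> y k \<le> x k + 1" for i x y
  proof -
    have "\<bar>g i x - g i y\<bar> \<le> (\<Sum>t<p. \<bar>\<tau> i (W x t) - \<tau> i (W y t)\<bar>)"
      unfolding g_def sum_subtractf[symmetric] by (rule sum_abs)
    also have "\<dots> \<le> (\<Sum>t<p. 2 * (\<Sum>j\<in>N. of_bool (W x t j \<noteq> W y t j)))"
    proof (rule sum_mono)
      fix t
      show "\<bar>\<tau> i (W x t) - \<tau> i (W y t)\<bar> \<le> 2 * (\<Sum>j\<in>N. of_bool (W x t j \<noteq> W y t j))"
      proof (cases "\<forall>j\<in>N. W x t j = W y t j")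
        case True
        then have "\<beta> (W x t) = \<beta> (W y t)" by (rule cong)
        then show ?thesis by (simp add: \<tau>_def sum_nonneg)
      next
        case False
        then obtain j where j: "j \<in> N" "W x t j \<noteq> W y t j" by blast
        have "(1::int) = of_bool (W x t j \<noteq> W y t j)" using j by simp
        also have "\<dots> \<le> (\<Sum>j\<in>N. of_bool (W x t j \<noteq> W y t j))"
          using j fin by (intro member_le_sum) auto
        finally show ?thesis by (auto simp: \<tau>_def)
      qed
    qed
    also have "\<dots> = 2 * (\<Sum>j\<in>N. \<Sum>t<p. of_bool (W x t j \<noteq> W y t j))"
      by (subst sum.swap) (simp add: sum_distrib_left)
    also have "\<dots> \<le> 2 * (\<Sum>j\<in>N. 1)"
    proof (intro mult_left_mono sum_mono)
      fix j assume "j \<in> N"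
      have "(\<Sum>t<p. of_bool (W x t j \<noteq> W y t j)) = int (card {t \<in> {..<p}. W x t j \<noteq> W y t j})"
        by (simp add: sum.If_cases of_bool_def Int_def)
      also have "\<dots> \<le> 1"
        using card_div_shift_le_1[of "x (e j)" "y (e j)" p] xy e(1)[OF \<open>j \<in> N\<close>]
        unfolding W_def by auto
      finally show "(\<Sum>t<p. of_bool (W x t j \<noteq> W y t j)) \<le> (1::int)" .
    qed auto
    finally show ?thesis by (simp add: n_def)
  qed
  obtain q where q: "\<forall>k<n. q k < K * p"
    "\<forall>i<n. \<exists>r s. (\<forall>j<n. q j \<le> r j \<and> r j \<le> q j + 1) \<and>
       (\<forall>j<n. q j \<le> s j \<and> s j \<le> q j + 1) \<and> lab r i \<noteq> lab s i"
    by (rule kuhn_lemma[of "K * p" n lab]) (use K p in \<open>auto simp: lab_def\<close>)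
  have "\<bar>int (card {t \<in> {..<p}. i \<in> \<beta> (\<lambda>j. (q (e j) + t) div p)})
        - int (card {t \<in> {..<p}. \<beta> (\<lambda>j. (q (e j) + t) div p) = {}})\<bar> \<le> 2 * int (card N)"
    if i: "i \<in> N" for i
  proof -
    obtain r s where rs: "\<forall>j<n. q j \<le> r j \<and> r j \<le> q j + 1"
      "\<forall>j<n. q j \<le> s j \<and> s j \<le> q j + 1" "lab r (e i) \<noteq> lab s (e i)"
      using q(2) e(1)[OF i] by blast
    have "lab r (e i) = 0 \<and> lab s (e i) = 1 \<or> lab r (e i) = 1 \<and> lab s (e i) = 0"
      using rs(3) by (auto simp: lab_def split: if_splits)
    then have "g i r \<ge> 0 \<and> g i s \<le> 0 \<or> g i r \<le> 0 \<and> g i s \<ge> 0"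
      using lab0[of r "e i"] lab1[of s "e i"] lab0[of s "e i"] lab1[of r "e i"] e[OF i] by auto
    then have "\<bar>g i q\<bar> \<le> 2 * int n"
      using near[OF rs(1), of i] near[OF rs(2), of i] by linarith
    moreover have "g i q = int (card {t \<in> {..<p}. i \<in> \<beta> (W q t)})
        - int (card {t \<in> {..<p}. \<beta> (W q t) = {}})"
      by (simp add: g_def \<tau>_def sum_subtractf sum.If_cases of_bool_def Int_def)
    ultimately show ?thesis by (simp add: n_def W_def)
  qed
  then show ?thesis by (rule that)
qed

lemma dual_core_exists:
  fixes N :: "'i set" and R :: "'i set \<Rightarrow> ('i \<Rightarrow> nat) set" and K Y :: nat
  assumes fin: "finite N"
    and ne: "\<And>P. P \<subseteq> N \<Longrightarrow> R P \<noteq> {}"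
    and bd: "\<And>P r i. P \<subseteq> N \<Longrightarrow> r \<in> R P \<Longrightarrow> i \<in> P \<Longrightarrow> r i \<le> K"
  obtains u :: "'i \<Rightarrow> nat" where
    "\<And>P r. P \<subseteq> N \<Longrightarrow> P \<noteq> {} \<Longrightarrow> r \<in> R P \<Longrightarrow> \<exists>i\<in>P. r i \<le> u i"
    "\<And>y :: 'i \<Rightarrow> int. (\<And>i. i \<in> N \<Longrightarrow> \<bar>y i\<bar> \<le> int Y) \<Longrightarrow>
       (\<And>P r. P \<subseteq> N \<Longrightarrow> r \<in> R P \<Longrightarrow> \<forall>i\<in>P. u i \<le> r i \<Longrightarrow> 0 \<le> sum y P) \<Longrightarrow> 0 \<le> sum y N"
proof -
  define good where "good w P \<longleftrightarrow> P \<subseteq> N \<and> P \<noteq> {} \<and> (\<exists>r\<in>R P. \<forall>i\<in>P. w i \<le> r i)"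
    for w :: "'i \<Rightarrow> nat" and P
  define \<beta> where "\<beta> w = (if \<exists>i\<in>N. w i = 0 then {i\<in>N. w i = 0}
     else if \<exists>P. good w P then SOME P. good w P else {})" for w
  have good: "good w (\<beta> w)" if "\<beta> w \<noteq> {}" for w
  proof (cases "\<exists>i\<in>N. w i = 0")
    case True
    then show ?thesis using ne[of "{i\<in>N. w i = 0}"] by (auto simp: \<beta>_def good_def)
  next
    case False
    then show ?thesis using that someI_ex[of "good w"] by (auto simp: \<beta>_def split: if_splits)
  qed
  have empty: "\<not> good w P" if "\<beta> w = {}" for w P
  proof -
    have pos: "\<not> (\<exists>i\<in>N. w i = 0)" using that by (auto simp: \<beta>_def split: if_splits)
    show "\<not> good w P"
    proof
      assume P: "good w P"
      then have "good w (\<beta> w)" using pos someI_ex[of "good w"] by (auto simp: \<beta>_def)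
      then show False using that by (simp add: good_def)
    qed
  qed
  define n where "n = card N"
  define L where "L = 2 * n * n * Y"
  define p where "p = (n + 1) * L + 2 * n * n + 1"
  have "p > 0" by (simp add: p_def)
  obtain q where q: "\<And>i. i \<in> N \<Longrightarrow> \<bar>int (card {t \<in> {..<p}. i \<in> \<beta> (\<lambda>j. (q j + t) div p)})
        - int (card {t \<in> {..<p}. \<beta> (\<lambda>j. (q j + t) div p) = {}})\<bar> \<le> 2 * int (card N)"
  proof (rule approximate_balance[OF fin, of "Suc K" p \<beta>])
    show "\<beta> w = \<beta> w'" if "\<forall>i\<in>N. w i = w' i" for w w'
    proof -
      have "good w P = good w' P" for P
      proof (cases "P \<subseteq> N")
        case True
        then have "\<forall>i\<in>P. w i = w' i" using that by blast
        then show ?thesis unfolding good_def by simp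
      qed (simp add: good_def)
      then have "good w = good w'" by blast
      moreover have "(\<exists>i\<in>N. w i = 0) = (\<exists>i\<in>N. w' i = 0)" "{i\<in>N. w i = 0} = {i\<in>N. w' i = 0}"
        using that by auto
      ultimately show ?thesis unfolding \<beta>_def by (simp only:)
    qed
    show "i \<in> \<beta> w" if "i \<in> N" "w i = 0" for w i using that by (auto simp: \<beta>_def)
    show "i \<notin> \<beta> w" if "i \<in> N" "w i = Suc K" for w i
    proof
      assume i: "i \<in> \<beta> w"
      then have "good w (\<beta> w)" using good by blast
      then obtain r where "r \<in> R (\<beta> w)" "\<beta> w \<subseteq> N" "w i \<le> r i" using i by (auto simp: good_def)
      then show False using bd[of "\<beta> w" r i] i that by simp
    qed
  qed (use \<open>p > 0\<close> in auto)
  define w where "w t = (\<lambda>j. (q j + t) div p)" for t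
  define z where "z = card {t \<in> {..<p}. \<beta> (w t) = {}}"
  define s where "s i = card {t \<in> {..<p}. i \<in> \<beta> (w t)}" for i
  have sz: "\<bar>int (s i) - int z\<bar> \<le> 2 * int n" if "i \<in> N" for i
    using q[OF that] by (simp add: s_def z_def w_def n_def)
  have "z > L"
  proof (rule ccontr)
    assume "\<not> z > L"
    have "{..<p} = {t \<in> {..<p}. \<beta> (w t) = {}} \<union> (\<Union>i\<in>N. {t \<in> {..<p}. i \<in> \<beta> (w t)})"
    proof -
      have "\<exists>i\<in>N. i \<in> \<beta> (w t)" if "\<beta> (w t) \<noteq> {}" for t
        using good[OF that] that unfolding good_def by blast
      then show ?thesis by auto
    qed
    then have "p = card ({t \<in> {..<p}. \<beta> (w t) = {}} \<union> (\<Union>i\<in>N. {t \<in> {..<p}. i \<in> \<beta> (w t)}))"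
      by (metis card_lessThan)
    also have "\<dots> \<le> z + card (\<Union>i\<in>N. {t \<in> {..<p}. i \<in> \<beta> (w t)})"
      unfolding z_def by (rule card_Un_le)
    also have "\<dots> \<le> z + (\<Sum>i\<in>N. s i)"
      unfolding s_def by (intro add_left_mono card_UN_le fin)
    also have "\<dots> \<le> z + (\<Sum>i\<in>N. z + 2 * n)"
      using sz by (intro add_left_mono sum_mono) fastforce
    also have "\<dots> = (n + 1) * z + 2 * n * n" by (simp add: n_def algebra_simps)
    also have "\<dots> \<le> (n + 1) * L + 2 * n * n"
      using \<open>\<not> z > L\<close> by (intro add_right_mono mult_left_mono) auto
    finally show False by (simp add: p_def)
  qed
  then have "{t \<in> {..<p}. \<beta> (w t) = {}} \<noteq> {}" by (metis card.empty not_less_zero z_def)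
  then obtain t0 where t0: "t0 < p" "\<beta> (w t0) = {}" by blast
  define u where "u i = w t0 i - 1" for i
  have wu: "u i \<le> w t i" if "t < p" for t i
  proof -
    have "(q i + t0) div p \<le> (q i + p) div p" using t0 by (intro div_le_mono) auto
    also have "\<dots> = Suc (q i div p)" using \<open>p > 0\<close> by simp
    also have "\<dots> \<le> Suc ((q i + t) div p)" by (simp add: div_le_mono)
    finally show ?thesis by (simp add: u_def w_def)
  qed
  show ?thesis
  proof (rule that[of u])
    fix P r assume P: "P \<subseteq> N" "P \<noteq> {}" "r \<in> R P"
    show "\<exists>i\<in>P. r i \<le> u i"
    proof (rule ccontr)
      assume "\<not> (\<exists>i\<in>P. r i \<le> u i)"
      then have "good (w t0) P" using P by (force simp: good_def u_def)
      then show False using empty t0 by blast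
    qed
  next
    fix y :: "'i \<Rightarrow> int"
    assume yY: "\<And>i. i \<in> N \<Longrightarrow> \<bar>y i\<bar> \<le> int Y"
      and y: "\<And>P r. P \<subseteq> N \<Longrightarrow> r \<in> R P \<Longrightarrow> \<forall>i\<in>P. u i \<le> r i \<Longrightarrow> 0 \<le> sum y P"
    have sub: "\<beta> (w t) \<subseteq> N" for t using good[of "w t"] by (auto simp: good_def)
    have "0 \<le> (\<Sum>t<p. sum y (\<beta> (w t)))"
    proof (rule sum_nonneg)
      fix t assume t: "t \<in> {..<p}"
      show "0 \<le> sum y (\<beta> (w t))"
      proof (cases "\<beta> (w t) = {}")
        case False
        then obtain r where r: "r \<in> R (\<beta> (w t))" "\<forall>i\<in>\<beta> (w t). w t i \<le> r i"
          using good unfolding good_def by blast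
        have "\<forall>i\<in>\<beta> (w t). u i \<le> r i" using r(2) order_trans[OF wu] t by auto
        then show ?thesis by (rule y[OF sub r(1)])
      qed simp
    qed
    also have "\<dots> = (\<Sum>t<p. \<Sum>i\<in>N. y i * of_bool (i \<in> \<beta> (w t)))"
    proof (rule sum.cong[OF refl])
      fix t
      have "sum y (\<beta> (w t)) = sum y (N \<inter> \<beta> (w t))" using sub[of t] by (simp add: inf.absorb2)
      also have "\<dots> = (\<Sum>i\<in>N. y i * of_bool (i \<in> \<beta> (w t)))"
        unfolding sum.inter_restrict[OF fin] by (intro sum.cong) auto
      finally show "sum y (\<beta> (w t)) = (\<Sum>i\<in>N. y i * of_bool (i \<in> \<beta> (w t)))" .
    qed
    also have "\<dots> = (\<Sum>i\<in>N. y i * (\<Sum>t<p. of_bool (i \<in> \<beta> (w t))))"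
      unfolding sum_distrib_left by (rule sum.swap)
    also have "\<dots> = (\<Sum>i\<in>N. y i * int (s i))"
      by (simp add: s_def sum.If_cases of_bool_def Int_def mult.commute)
    also have "\<dots> = int z * sum y N + (\<Sum>i\<in>N. y i * (int (s i) - int z))"
      by (simp add: sum_distrib_left algebra_simps sum_subtractf)
    also have "(\<Sum>i\<in>N. y i * (int (s i) - int z)) \<le> (\<Sum>i\<in>N. int Y * (2 * int n))"
    proof (rule sum_mono)
      fix i assume i: "i \<in> N"
      have "y i * (int (s i) - int z) \<le> \<bar>y i\<bar> * \<bar>int (s i) - int z\<bar>"
        by (metis abs_ge_self abs_mult)
      also have "\<dots> \<le> int Y * (2 * int n)" using yY[OF i] sz[OF i] by (intro mult_mono) auto
      finally show "y i * (int (s i) - int z) \<le> int Y * (2 * int n)" .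
    qed
    also have "(\<Sum>i\<in>N. int Y * (2 * int n)) = int L" by (simp add: L_def n_def)
    finally have *: "0 \<le> int z * sum y N + int L" by simp
    show "0 \<le> sum y N"
    proof (rule ccontr)
      assume "\<not> 0 \<le> sum y N"
      then have "int z * sum y N \<le> int z * (-1)" by (intro mult_left_mono) auto
      then show False using * \<open>z > L\<close> by linarith
    qed
  qed
qed

section \<open>Hall's theorem\<close>

lemma hall_marriage:
  fixes \<Gamma> :: "'a \<Rightarrow> 'b set"
  assumes "finite A" "\<And>x. x \<in> A \<Longrightarrow> finite (\<Gamma> x)"
    and "\<And>X. X \<subseteq> A \<Longrightarrow> card X \<le> card (\<Union>(\<Gamma> ` X))"
  shows "\<exists>f. inj_on f A \<and> (\<forall>x\<in>A. f x \<in> \<Gamma> x)"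
  using assms
proof (induction A arbitrary: \<Gamma> rule: finite_psubset_induct)
  case (psubset A)
  note fin = psubset.prems(1) and hall = psubset.prems(2)
  have finU: "finite (\<Union>(\<Gamma> ` X))" if "X \<subseteq> A" for X
    using that fin psubset.hyps by (meson finite_UN_I rev_finite_subset subsetD)
  consider "A = {}" | X0 where "X0 \<subset> A" "X0 \<noteq> {}" "card (\<Union>(\<Gamma> ` X0)) \<le> card X0"
    | a where "a \<in> A" "\<And>X. X \<subset> A \<Longrightarrow> X \<noteq> {} \<Longrightarrow> card X < card (\<Union>(\<Gamma> ` X))"
    by (meson ex_in_conv linorder_not_less)
  then show ?case
  proof cases
    case 1
    then show ?thesis by simp
  next
    case 2
    define B where "B = \<Union>(\<Gamma> ` X0)"
    have "\<exists>f. inj_on f X0 \<and> (\<forall>x\<in>X0. f x \<in> \<Gamma> x)"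
      using 2 fin hall by (intro psubset.IH) auto
    then obtain f where f: "inj_on f X0" "\<forall>x\<in>X0. f x \<in> \<Gamma> x" by blast
    have "\<exists>g. inj_on g (A - X0) \<and> (\<forall>x\<in>A - X0. g x \<in> \<Gamma> x - B)"
    proof (rule psubset.IH)
      show "A - X0 \<subset> A" using 2 by blast
      show "finite (\<Gamma> x - B)" if "x \<in> A - X0" for x using fin that by auto
      fix X assume X: "X \<subseteq> A - X0"
      have "card X + card X0 = card (X \<union> X0)"
        using X 2 psubset.hyps by (subst card_Un_disjoint) (auto intro: finite_subset)
      also have "\<dots> \<le> card (\<Union>(\<Gamma> ` (X \<union> X0)))" using X 2 by (intro hall) auto
      also have "\<Union>(\<Gamma> ` (X \<union> X0)) = (\<Union>x\<in>X. \<Gamma> x - B) \<union> B" by (auto simp: B_def)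
      also have "card \<dots> \<le> card (\<Union>x\<in>X. \<Gamma> x - B) + card B" by (rule card_Un_le)
      finally show "card X \<le> card (\<Union>x\<in>X. \<Gamma> x - B)" using 2 by (simp add: B_def)
    qed
    then obtain g where g: "inj_on g (A - X0)" "\<forall>x\<in>A - X0. g x \<in> \<Gamma> x - B" by blast
    define k where "k x = (if x \<in> X0 then f x else g x)" for x
    have "f x \<in> B" if "x \<in> X0" for x using f that by (auto simp: B_def)
    then have "inj_on k A"
      using f(1) g unfolding inj_on_def k_def by (metis Diff_iff)
    moreover have "\<forall>x\<in>A. k x \<in> \<Gamma> x" using f g by (auto simp: k_def)
    ultimately show ?thesis by blast
  next
    case 3
    have "\<Gamma> a \<noteq> {}" using hall[of "{a}"] 3 by auto
    then obtain b where b: "b \<in> \<Gamma> a" by blast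
    have "\<exists>g. inj_on g (A - {a}) \<and> (\<forall>x\<in>A - {a}. g x \<in> \<Gamma> x - {b})"
    proof (rule psubset.IH)
      show "A - {a} \<subset> A" using 3 by blast
      show "finite (\<Gamma> x - {b})" if "x \<in> A - {a}" for x using fin that by auto
      fix X assume X: "X \<subseteq> A - {a}"
      show "card X \<le> card (\<Union>x\<in>X. \<Gamma> x - {b})"
      proof (cases "X = {}")
        case False
        have "card X < card (\<Union>(\<Gamma> ` X))" using X False 3 by (intro 3(2)) auto
        also have "\<dots> \<le> Suc (card (\<Union>(\<Gamma> ` X) - {b}))"
          using diff_card_le_card_Diff[of "{b}" "\<Union>(\<Gamma> ` X)"] by simp
        also have "\<Union>(\<Gamma> ` X) - {b} = (\<Union>x\<in>X. \<Gamma> x - {b})" by auto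
        finally show ?thesis by simp
      qed simp
    qed
    then obtain g where g: "inj_on g (A - {a})" "\<forall>x\<in>A - {a}. g x \<in> \<Gamma> x - {b}" by blast
    have "inj_on (g(a := b)) A" using g 3 unfolding inj_on_def by auto
    moreover have "\<forall>x\<in>A. (g(a := b)) x \<in> \<Gamma> x" using g b by auto
    ultimately show ?thesis by blast
  qed
qed

section \<open>Matchings and odd cycles\<close>

lemma is_matching_disjoint:
  "is_matching E W M \<Longrightarrow> e \<in> M \<Longrightarrow> f \<in> M \<Longrightarrow> e \<noteq> f \<Longrightarrow> e \<inter> f = {}"
  by (simp add: is_matching_def)

lemma is_matching_Un:
  assumes "is_matching E W M" "is_matching E W' M'" "W \<inter> W' = {}"
  shows "is_matching E (W \<union> W') (M \<union> M')"
proof -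
  have "e \<inter> f = {}" if "e \<in> M" "f \<in> M'" for e f
  proof -
    have "e \<subseteq> W" "f \<subseteq> W'" using assms that by (auto simp: is_matching_def)
    then show ?thesis using assms(3) by blast
  qed
  then have "\<forall>e\<in>M \<union> M'. \<forall>f\<in>M \<union> M'. e \<noteq> f \<longrightarrow> e \<inter> f = {}"
    using assms(1,2) unfolding is_matching_def by (metis Int_commute UnE)
  then show ?thesis using assms(1,2) by (auto simp: is_matching_def)
qed

lemma is_matching_UN:
  assumes "\<And>j. j \<in> J \<Longrightarrow> is_matching E (W j) (M j)"
    and "\<And>j k. j \<in> J \<Longrightarrow> k \<in> J \<Longrightarrow> j \<noteq> k \<Longrightarrow> W j \<inter> W k = {}"
  shows "is_matching E (\<Union>j\<in>J. W j) (\<Union>j\<in>J. M j)"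
proof -
  have disj: "e \<inter> f = {}" if "j \<in> J" "k \<in> J" "e \<in> M j" "f \<in> M k" "e \<noteq> f" for j k e f
  proof (cases "j = k")
    case True
    then show ?thesis using assms(1)[of j] that unfolding is_matching_def by blast
  next
    case False
    have "e \<subseteq> W j" "f \<subseteq> W k" using assms(1) that unfolding is_matching_def by auto
    then show ?thesis using assms(2)[OF that(1,2) False] by blast
  qed
  show ?thesis
    unfolding is_matching_def
  proof (intro conjI ballI impI)
    have sub: "M j \<subseteq> E" "\<forall>e\<in>M j. e \<subseteq> W j" if "j \<in> J" for j
      using assms(1)[OF that] by (auto simp: is_matching_def)
    show "(\<Union>j\<in>J. M j) \<subseteq> E" using sub(1) by (rule UN_least)
    show "e \<subseteq> (\<Union>j\<in>J. W j)" if "e \<in> (\<Union>j\<in>J. M j)" for e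
      using sub(2) that by (elim UN_E) (blast intro: UN_upper)
    show "e \<inter> f = {}" if "e \<in> (\<Union>j\<in>J. M j)" "f \<in> (\<Union>j\<in>J. M j)" "e \<noteq> f" for e f
      using disj that by (elim UN_E) simp
  qed
qed

lemma is_matching_mono: "is_matching E W M \<Longrightarrow> W \<subseteq> W' \<Longrightarrow> is_matching E W' M"
  unfolding is_matching_def by (meson subset_trans)

lemma even_path_perfect_matching:
  assumes "distinct xs" "even (length xs)"
    and "\<And>i. Suc i < length xs \<Longrightarrow> {xs ! i, xs ! Suc i} \<in> E"
  shows "\<exists>M. is_matching E (set xs) M \<and> \<Union>M = set xs"
  using assms
proof (induction xs rule: induct_list012)
  case 1
  then show ?case by (intro exI[of _ "{}"]) (simp add: is_matching_def)
next
  case (2 x)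
  then show ?case by simp
next
  case (3 x y zs)
  have "{zs ! i, zs ! Suc i} \<in> E" if "Suc i < length zs" for i
    using 3(5)[of "Suc (Suc i)"] that by simp
  then obtain M where M: "is_matching E (set zs) M" "\<Union>M = set zs"
    using 3 by fastforce
  have "is_matching E {x, y} {{x, y}}" using 3(5)[of 0] by (simp add: is_matching_def)
  then have "is_matching E ({x, y} \<union> set zs) ({{x, y}} \<union> M)"
    using M 3(3) by (intro is_matching_Un) auto
  then show ?case using M(2) by (intro exI[of _ "{{x, y}} \<union> M"]) (simp add: insert_commute)
qed

lemma odd_cycle_minus_vertex_perfect_matching:
  assumes c: "odd_cycle E c" and x: "x \<in> set c"
  shows "\<exists>M. is_matching E (set c - {x}) M \<and> \<Union>M = set c - {x}"
proof -
  define n where "n = length c"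
  obtain k where k: "k < n" "c ! k = x" using x by (auto simp: in_set_conv_nth n_def)
  have n: "odd n" "distinct c" and E: "\<And>i. i < n \<Longrightarrow> {c ! i, c ! (Suc i mod n)} \<in> E"
    using c by (auto simp: odd_cycle_def n_def)
  define ys where "ys = rotate k c"
  have nth: "ys ! i = c ! ((k + i) mod n)" if "i < n" for i
    using that by (simp add: ys_def nth_rotate n_def)
  have "ys \<noteq> []" using k by (auto simp: ys_def n_def)
  moreover from this have "hd ys = x" using k nth[of 0] by (simp add: hd_conv_nth)
  ultimately have ys: "ys = x # tl ys" by (metis list.collapse)
  have len: "length ys = n" "distinct ys" "set ys = set c" using n by (auto simp: ys_def n_def)
  have "\<exists>M. is_matching E (set (tl ys)) M \<and> \<Union>M = set (tl ys)"
  proof (rule even_path_perfect_matching)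
    show "distinct (tl ys)" using len by (simp add: distinct_tl)
    show "even (length (tl ys))" using len n by simp
    fix i assume i: "Suc i < length (tl ys)"
    then have i': "Suc (Suc i) < n" using len by simp
    have "{ys ! Suc i, ys ! Suc (Suc i)} = {c ! ((k + Suc i) mod n), c ! (Suc ((k + Suc i) mod n) mod n)}"
      using i' by (simp add: nth mod_Suc_eq)
    also have "\<dots> \<in> E" using i' by (intro E) auto
    finally show "{tl ys ! i, tl ys ! Suc i} \<in> E" using i by (simp add: nth_tl)
  qed
  moreover have "set (tl ys) = set c - {x}" using len ys
    by (metis Diff_insert_absorb distinct.simps(2) list.simps(15))
  ultimately show ?thesis by simp
qed

definition cycle_packing :: "'a set set \<Rightarrow> 'a set \<Rightarrow> 'a set set \<Rightarrow> 'a list set \<Rightarrow> bool" where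
  "cycle_packing E W M C \<longleftrightarrow> is_matching E W M \<and> finite C \<and>
     (\<forall>c\<in>C. odd_cycle E c \<and> set c \<subseteq> W \<and> set c \<inter> \<Union>M = {}) \<and>
     (\<forall>c\<in>C. \<forall>c'\<in>C. c \<noteq> c' \<longrightarrow> set c \<inter> set c' = {})"

lemma cycle_packing_Un:
  assumes "cycle_packing E W M C" "cycle_packing E W' M' C'" "W \<inter> W' = {}"
  shows "cycle_packing E (W \<union> W') (M \<union> M') (C \<union> C')"
proof -
  have "is_matching E (W \<union> W') (M \<union> M')"
    using assms by (intro is_matching_Un) (auto simp: cycle_packing_def)
  moreover have sub: "\<Union>M \<subseteq> W" "\<Union>M' \<subseteq> W'" "\<And>c. c \<in> C \<Longrightarrow> set c \<subseteq> W" "\<And>c. c \<in> C' \<Longrightarrow> set c \<subseteq> W'"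
    using assms by (auto simp: cycle_packing_def is_matching_def)
  have "set c \<inter> \<Union>M' = {}" if "c \<in> C" for c using sub(3)[OF that] sub(2) assms(3) by blast
  moreover have "set c \<inter> \<Union>M = {}" if "c \<in> C'" for c using sub(4)[OF that] sub(1) assms(3) by blast
  moreover have "set c \<inter> set c' = {}" if "c \<in> C" "c' \<in> C'" for c c'
    using sub(3)[OF that(1)] sub(4)[OF that(2)] assms(3) by blast
  moreover have "set c' \<inter> set c = {}" if "c \<in> C" "c' \<in> C'" for c c'
    using sub(3)[OF that(1)] sub(4)[OF that(2)] assms(3) by blast
  ultimately show ?thesis
    using assms(1,2) unfolding cycle_packing_def Union_Un_distrib Int_Un_distrib
    by (intro conjI ballI impI; (elim UnE)?) (simp_all add: le_supI1 le_supI2)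
qed

lemma cycle_packing_mono: "cycle_packing E W M C \<Longrightarrow> W \<subseteq> W' \<Longrightarrow> cycle_packing E W' M C"
  unfolding cycle_packing_def by (meson is_matching_mono subset_trans)

lemma cycle_packing_matching: "is_matching E W M \<Longrightarrow> cycle_packing E W M {}"
  by (simp add: cycle_packing_def)

text \<open>An injection along edges decomposes its domain into paths, whose last vertex need not be
  covered, and cycles; only the odd cycles have no matching that covers what is required.\<close>

lemma cycle_packing_of_injection:
  assumes "finite S" "inj_on \<pi> S" "\<And>v. v \<in> S \<Longrightarrow> {v, \<pi> v} \<in> E" "\<And>v. {v} \<notin> E"
  shows "\<exists>M C. cycle_packing E (S \<union> \<pi> ` S) M C \<and> S \<subseteq> \<Union>M \<union> \<Union>(set ` C)"
  using assms(1-3)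
proof (induction S rule: finite_psubset_induct)
  case (psubset S)
  note inj = psubset.prems(1) and edge = psubset.prems(2)
  consider "S = {}" | s where "s \<in> S" "s \<notin> \<pi> ` S" | "S \<noteq> {}" "S \<subseteq> \<pi> ` S" by blast
  then show ?case
  proof cases
    case 1
    then show ?thesis by (intro exI[of _ "{}"]) (simp add: cycle_packing_def is_matching_def)
  next
    case 2
    define S' where "S' = S - {s, \<pi> s}"
    have "\<exists>M C. cycle_packing E (S' \<union> \<pi> ` S') M C \<and> S' \<subseteq> \<Union>M \<union> \<Union>(set ` C)"
      using 2 edge by (intro psubset.IH inj_on_subset[OF inj]) (auto simp: S'_def)
    then obtain M C where MC: "cycle_packing E (S' \<union> \<pi> ` S') M C" "S' \<subseteq> \<Union>M \<union> \<Union>(set ` C)"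
      by blast
    have "\<pi> v \<noteq> \<pi> s" if "v \<in> S'" for v
      using that inj_onD[OF inj, of v s] 2 by (auto simp: S'_def)
    then have "\<pi> s \<notin> \<pi> ` S'" by fastforce
    moreover have "s \<notin> \<pi> ` S'" "s \<notin> S'" "\<pi> s \<notin> S'" using 2 by (auto simp: S'_def)
    ultimately have "{s, \<pi> s} \<inter> (S' \<union> \<pi> ` S') = {}" by simp
    moreover have "cycle_packing E {s, \<pi> s} {{s, \<pi> s}} {}"
      using edge 2 by (intro cycle_packing_matching) (simp add: is_matching_def)
    ultimately have "cycle_packing E ({s, \<pi> s} \<union> (S' \<union> \<pi> ` S')) ({{s, \<pi> s}} \<union> M) ({} \<union> C)"
      using MC by (intro cycle_packing_Un) auto
    then have "cycle_packing E (S \<union> \<pi> ` S) ({{s, \<pi> s}} \<union> M) C"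
      unfolding Un_empty_left by (rule cycle_packing_mono) (use 2 in \<open>auto simp: S'_def\<close>)
    moreover have "S \<subseteq> \<Union>({{s, \<pi> s}} \<union> M) \<union> \<Union>(set ` C)" using MC(2) by (auto simp: S'_def)
    ultimately show ?thesis by blast
  next
    case 3
    then have img: "\<pi> ` S = S"
      using psubset.hyps by (metis card_image_le card_seteq finite_imageI)
    obtain s where s: "s \<in> S" using 3 by blast
    have orb: "(\<pi> ^^ k) s \<in> S" for k by (induction k) (use s img in auto)
    define rep where "rep b \<longleftrightarrow> (\<exists>a<b. (\<pi> ^^ a) s = (\<pi> ^^ b) s)" for b
    have "\<not> inj (\<lambda>k. (\<pi> ^^ k) s)"
      using orb psubset.hyps by (metis finite_subset image_subsetI infinite_UNIV_nat finite_image_iff)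
    then have "\<exists>b. rep b" unfolding rep_def inj_on_def by (metis nat_neq_iff)
    define b where "b = (LEAST b. rep b)"
    have "rep b" unfolding b_def by (rule LeastI_ex) fact
    have least: "\<not> rep k" if "k < b" for k using that not_less_Least unfolding b_def by blast
    obtain a where a: "a < b" "(\<pi> ^^ a) s = (\<pi> ^^ b) s" using \<open>rep b\<close> by (auto simp: rep_def)
    have "a = 0"
    proof (rule ccontr)
      assume "a \<noteq> 0"
      then obtain a' b' where ab: "a = Suc a'" "b = Suc b'" using a by (metis not0_implies_Suc not_less_zero)
      then have "(\<pi> ^^ a') s = (\<pi> ^^ b') s" using a orb inj by (auto dest: inj_onD)
      then have "rep b'" using a ab by (auto simp: rep_def)
      then show False using least ab by blast
    qed
    then have b: "b > 0" "(\<pi> ^^ b) s = s" using a by auto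
    define c where "c = map (\<lambda>i. (\<pi> ^^ i) s) [0..<b]"
    have len: "length c = b" and nth: "\<And>i. i < b \<Longrightarrow> c ! i = (\<pi> ^^ i) s" by (auto simp: c_def)
    have "distinct c"
      unfolding distinct_conv_nth
    proof (intro allI impI)
      fix i j assume ij: "i < length c" "j < length c" "i \<noteq> j"
      then have "\<not> rep i" "\<not> rep j" using least len by auto
      moreover have "i < j \<or> j < i" using ij by linarith
      ultimately show "c ! i \<noteq> c ! j" using ij by (metis rep_def len nth)
    qed
    have cS: "set c \<subseteq> S" using orb by (auto simp: c_def)
    have next_nth: "c ! (Suc i mod b) = \<pi> (c ! i)" if "i < b" for i
    proof (cases "Suc i = b")
      case True
      then show ?thesis using b by (simp add: nth flip: True)
    qed (use that in \<open>simp add: nth\<close>)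
    have edges: "{c ! i, c ! (Suc i mod b)} \<in> E" if "i < b" for i
      using edge[OF orb, of i] unfolding next_nth[OF that] nth[OF that] .
    have "\<exists>M C. cycle_packing E (set c) M C \<and> set c \<subseteq> \<Union>M \<union> \<Union>(set ` C)"
    proof (cases "even b")
      case True
      have "{c ! i, c ! Suc i} \<in> E" if "Suc i < length c" for i
        using edges[of i] that len by simp
      then obtain M where "is_matching E (set c) M" "\<Union>M = set c"
        using even_path_perfect_matching[OF \<open>distinct c\<close>] True len by metis
      then show ?thesis
        by (intro exI[of _ M] exI[of _ "{}"]) (simp add: cycle_packing_matching)
    next
      case False
      have "b \<noteq> 1" using edges[of 0] assms(4) by auto
      then have "odd_cycle E c" using False b edges len \<open>distinct c\<close>
        unfolding odd_cycle_def by (auto elim!: oddE)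
      then show ?thesis
        by (intro exI[of _ "{}"] exI[of _ "{c}"]) (simp add: cycle_packing_def is_matching_def)
    qed
    then obtain M C where MC: "cycle_packing E (set c) M C" "set c \<subseteq> \<Union>M \<union> \<Union>(set ` C)" by blast
    define S' where "S' = S - set c"
    have "s \<in> set c" using b by (auto simp: c_def intro!: image_eqI[of _ _ 0])
    then have "\<exists>M C. cycle_packing E (S' \<union> \<pi> ` S') M C \<and> S' \<subseteq> \<Union>M \<union> \<Union>(set ` C)"
      using s edge by (intro psubset.IH inj_on_subset[OF inj]) (auto simp: S'_def)
    then obtain M' C' where MC': "cycle_packing E (S' \<union> \<pi> ` S') M' C'" "S' \<subseteq> \<Union>M' \<union> \<Union>(set ` C')"
      by blast
    have "\<pi> ` set c \<subseteq> set c"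
    proof
      fix x assume "x \<in> \<pi> ` set c"
      then obtain i where "i < b" "x = \<pi> (c ! i)" by (auto simp: in_set_conv_nth len)
      then show "x \<in> set c" using next_nth[of i] b len by (metis mod_less_divisor nth_mem)
    qed
    then have "\<pi> ` set c = set c"
      using card_image[OF inj_on_subset[OF inj cS]] by (metis List.finite_set card_subset_eq)
    then have "set c \<inter> \<pi> ` S' = {}"
      using inj_on_image_Int[OF inj cS, of S'] by (auto simp: S'_def)
    then have "cycle_packing E (set c \<union> (S' \<union> \<pi> ` S')) (M \<union> M') (C \<union> C')"
      using MC MC' by (intro cycle_packing_Un) (auto simp: S'_def)
    then have "cycle_packing E (S \<union> \<pi> ` S) (M \<union> M') (C \<union> C')"
      by (rule cycle_packing_mono) (use cS in \<open>auto simp: S'_def\<close>)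
    moreover have "S \<subseteq> \<Union>(M \<union> M') \<union> \<Union>(set ` (C \<union> C'))"
    proof
      fix x assume "x \<in> S"
      then have "x \<in> set c \<or> x \<in> S'" by (auto simp: S'_def)
      then show "x \<in> \<Union>(M \<union> M') \<union> \<Union>(set ` (C \<union> C'))" using MC(2) MC'(2) by blast
    qed
    ultimately show ?thesis by blast
  qed
qed

text \<open>Two odd cycles joined by an edge xy are perfectly matched by xy together with perfect
  matchings of the two cycles minus x and y.\<close>

lemma cycle_packing_merge_cycles:
  assumes pack: "cycle_packing E W M C" and cc: "c \<in> C" "c' \<in> C" "c \<noteq> c'"
    and xy: "x \<in> set c" "y \<in> set c'" "{x, y} \<in> E"
  shows "\<exists>M'. cycle_packing E W M' (C - {c, c'}) \<and>
     \<Union>M \<union> \<Union>(set ` C) \<subseteq> \<Union>M' \<union> \<Union>(set ` (C - {c, c'}))"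
proof -
  have disj: "set c \<inter> set c' = {}" and odd: "odd_cycle E c" "odd_cycle E c'"
    and sub: "set c \<subseteq> W" "set c' \<subseteq> W" and M: "set c \<inter> \<Union>M = {}" "set c' \<inter> \<Union>M = {}"
    using pack cc by (auto simp: cycle_packing_def)
  obtain M1 where M1: "is_matching E (set c - {x}) M1" "\<Union>M1 = set c - {x}"
    using odd_cycle_minus_vertex_perfect_matching[OF odd(1) xy(1)] by metis
  obtain M2 where M2: "is_matching E (set c' - {y}) M2" "\<Union>M2 = set c' - {y}"
    using odd_cycle_minus_vertex_perfect_matching[OF odd(2) xy(2)] by metis
  define W' where "W' = W - (set c \<union> set c')"
  have "is_matching E {x, y} {{x, y}}" using xy by (simp add: is_matching_def)
  then have "is_matching E ({x, y} \<union> ((set c - {x}) \<union> (set c' - {y}))) ({{x, y}} \<union> (M1 \<union> M2))"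
    using M1 M2 disj xy by (intro is_matching_Un) auto
  then have "is_matching E (set c \<union> set c') ({{x, y}} \<union> (M1 \<union> M2))"
    by (rule is_matching_mono) (use xy in auto)
  then have 1: "cycle_packing E (set c \<union> set c') ({{x, y}} \<union> (M1 \<union> M2)) {}"
    by (rule cycle_packing_matching)
  have "is_matching E (\<Union>M) M" "\<Union>M \<subseteq> W"
    using pack by (auto simp: cycle_packing_def is_matching_def)
  moreover from this(2) have "\<Union>M \<subseteq> W'" using M unfolding W'_def by blast
  ultimately have "is_matching E W' M" using is_matching_mono by metis
  moreover have "set d \<subseteq> W'" if "d \<in> C - {c, c'}" for d
  proof -
    have "set d \<inter> set c = {}" "set d \<inter> set c' = {}" "set d \<subseteq> W"
      using pack cc that by (auto simp: cycle_packing_def)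
    then show ?thesis unfolding W'_def by blast
  qed
  ultimately have 2: "cycle_packing E W' M (C - {c, c'})"
    using pack by (auto simp: cycle_packing_def)
  have "cycle_packing E ((set c \<union> set c') \<union> W') (({{x, y}} \<union> (M1 \<union> M2)) \<union> M) ({} \<union> (C - {c, c'}))"
    using 1 2 by (rule cycle_packing_Un) (auto simp: W'_def)
  moreover have "(set c \<union> set c') \<union> W' = W" using sub by (auto simp: W'_def)
  moreover have "\<Union>M \<union> \<Union>(set ` C) \<subseteq> \<Union>(({{x, y}} \<union> (M1 \<union> M2)) \<union> M) \<union> \<Union>(set ` (C - {c, c'}))"
    unfolding Union_Un_distrib M1(2) M2(2) using xy by auto
  ultimately show ?thesis by (metis Un_empty_left)
qed

lemma independent_cycle_packing_exists:
  assumes "cycle_packing E W M C" "S \<subseteq> \<Union>M \<union> \<Union>(set ` C)"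
  shows "\<exists>M C. cycle_packing E W M C \<and> S \<subseteq> \<Union>M \<union> \<Union>(set ` C) \<and> indep_odd_cycles E C"
  using assms
proof (induction "card C" arbitrary: M C rule: less_induct)
  case less
  show ?case
  proof (cases "indep_odd_cycles E C")
    case True
    then show ?thesis using less.prems by metis
  next
    case False
    have disj: "finite C" "\<forall>c\<in>C. odd_cycle E c"
        "\<forall>c\<in>C. \<forall>c'\<in>C. c \<noteq> c' \<longrightarrow> set c \<inter> set c' = {}"
      using less.prems(1) by (auto simp: cycle_packing_def)
    obtain c c' x y where cc: "c \<in> C" "c' \<in> C" "c \<noteq> c'" "x \<in> set c" "y \<in> set c'" "{x, y} \<in> E"
      using disj False unfolding indep_odd_cycles_def by metis
    then obtain M' where M': "cycle_packing E W M' (C - {c, c'})"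
      "\<Union>M \<union> \<Union>(set ` C) \<subseteq> \<Union>M' \<union> \<Union>(set ` (C - {c, c'}))"
      using cycle_packing_merge_cycles[OF less.prems(1) cc] by fastforce
    have "finite C" using less.prems(1) by (simp add: cycle_packing_def)
    then have "card (C - {c, c'}) < card C" using cc by (intro psubset_card_mono) auto
    then show ?thesis using M' less.prems(2) by (intro less.hyps) (assumption, assumption, rule subset_trans)
  qed
qed

section \<open>Supplementing the graph by donors\<close>

lemma odd_cycle_vertices_subset:
  assumes "odd_cycle E c"
  shows "set c \<subseteq> \<Union>E"
proof
  fix x assume "x \<in> set c"
  then obtain i where "i < length c" "x = c ! i" by (auto simp: in_set_conv_nth)
  then have "{x, c ! ((i + 1) mod length c)} \<in> E" using assms by (simp add: odd_cycle_def)
  then show "x \<in> \<Union>E" by blast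
qed

lemma card_indep_odd_cycles_le_nu:
  assumes fin: "finite (\<Union>E)" and C: "indep_odd_cycles E C"
  shows "card C \<le> nu E"
proof -
  have "card D \<le> card (\<Union>E)" if D: "indep_odd_cycles E D" for D
  proof (rule card_inj_on_le[OF _ _ fin])
    have hd_in: "hd c \<in> set c" "set c \<subseteq> \<Union>E" if "c \<in> D" for c
      using D that odd_cycle_vertices_subset[of E c]
      by (auto simp: indep_odd_cycles_def odd_cycle_def intro!: hd_in_set)
    then show "hd ` D \<subseteq> \<Union>E" by blast
    show "inj_on hd D"
    proof (rule inj_onI, rule ccontr)
      fix c c' assume cc: "c \<in> D" "c' \<in> D" "hd c = hd c'" "c \<noteq> c'"
      then have "set c \<inter> set c' = {}" using D by (simp add: indep_odd_cycles_def)
      then show False using hd_in(1)[OF cc(1)] hd_in(1)[OF cc(2)] cc(3) by auto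
    qed
  qed
  then have "{card C | C. indep_odd_cycles E C} \<subseteq> {..card (\<Union>E)}" by auto
  then have "finite {card C | C. indep_odd_cycles E C}" by (rule finite_subset) simp
  then show ?thesis unfolding nu_def using C by (intro Max_ge) auto
qed

lemma bipartite_no_odd_cycle:
  assumes "bipartite E"
  shows "\<not> odd_cycle E c"
proof
  assume c: "odd_cycle E c"
  obtain X where X: "\<And>e. e \<in> E \<Longrightarrow> \<exists>x y. e = {x, y} \<and> x \<in> X \<and> y \<notin> X"
    using assms by (auto simp: bipartite_def)
  have alt: "a \<in> X \<longleftrightarrow> b \<notin> X" if "{a, b} \<in> E" for a b
    using X[OF that] by (auto simp: doubleton_eq_iff)
  define n where "n = length c"
  have n: "odd n" "n \<ge> 3" and E: "\<And>i. i < n \<Longrightarrow> {c ! i, c ! (Suc i mod n)} \<in> E"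
    using c by (auto simp: odd_cycle_def n_def)
  have "c ! i \<in> X \<longleftrightarrow> (c ! 0 \<in> X \<longleftrightarrow> even i)" if "i < n" for i
    using that
  proof (induction i)
    case (Suc i)
    then have "c ! i \<in> X \<longleftrightarrow> c ! Suc i \<notin> X" using E[of i] alt by simp
    then show ?case using Suc by auto
  qed simp
  from this[of "n - 1"] have "c ! (n - 1) \<in> X \<longleftrightarrow> c ! 0 \<in> X" using n by auto
  moreover have "{c ! (n - 1), c ! 0} \<in> E" using E[of "n - 1"] n by simp
  ultimately show False using alt by blast
qed

lemma card_le_util:
  assumes "finite U" "S \<inter> U \<subseteq> \<Union>M"
  shows "card (S \<inter> U) \<le> util U M"
  unfolding util_def using assms by (intro card_mono) auto

lemma is_matching_image_Inl:
  fixes E :: "'a set set"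
  assumes "is_matching E W M"
  shows "is_matching (aug_edges E d A) (Inl ` W) ((`) Inl ` M)"
proof -
  have "Inl ` e \<inter> Inl ` f = ({} :: ('a + nat) set)" if "e \<in> M" "f \<in> M" "e \<noteq> f" for e f
  proof -
    have "e \<inter> f = {}" using assms that by (simp add: is_matching_def)
    then show ?thesis by blast
  qed
  then have "e' \<inter> f' = {}" if "e' \<in> (`) Inl ` M" "f' \<in> (`) Inl ` M" "e' \<noteq> f'"
    for e' f' :: "('a + nat) set"
    using that by (elim imageE) auto
  moreover have "(`) Inl ` M \<subseteq> aug_edges E d A" "\<forall>e\<in>(`) Inl ` M. e \<subseteq> Inl ` W"
    using assms by (auto simp: is_matching_def aug_edges_def)
  ultimately show ?thesis unfolding is_matching_def by simp
qed

lemma donors_cover_cycle_packing: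
  fixes E :: "'a set set"
  assumes pack: "cycle_packing E V M C"
  shows "\<exists>A M'. (\<forall>j<card C. A j \<subseteq> V) \<and>
     is_matching (aug_edges E (card C) A) (aug_vertices V (card C)) M' \<and>
     Inl ` (\<Union>M \<union> \<Union>(set ` C)) \<subseteq> \<Union>M'"
proof -
  define d where "d = card C"
  have "finite C" and odd: "\<And>c. c \<in> C \<Longrightarrow> odd_cycle E c" and CV: "\<And>c. c \<in> C \<Longrightarrow> set c \<subseteq> V"
    and CM: "\<And>c. c \<in> C \<Longrightarrow> set c \<inter> \<Union>M = {}"
    and CC: "\<And>c c'. c \<in> C \<Longrightarrow> c' \<in> C \<Longrightarrow> c \<noteq> c' \<Longrightarrow> set c \<inter> set c' = {}"
    and M: "is_matching E V M"
    using pack by (auto simp: cycle_packing_def)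
  obtain g where g: "bij_betw g {..<d} C"
    using ex_bij_betw_nat_finite[OF \<open>finite C\<close>] unfolding d_def atLeast0LessThan by blast
  have gC: "g j \<in> C" if "j < d" for j using g that by (auto simp: bij_betw_def)
  have hd: "hd (g j) \<in> set (g j)" if "j < d" for j
    using odd[OF gC[OF that]] by (auto simp: odd_cycle_def intro!: hd_in_set)
  define A where "A j = (if j < d then set (g j) else {})" for j
  have "\<exists>m. is_matching E (set (g j) - {hd (g j)}) m \<and> \<Union>m = set (g j) - {hd (g j)}" if "j < d" for j
    using odd_cycle_minus_vertex_perfect_matching[OF odd[OF gC[OF that]] hd[OF that]] .
  then obtain m where m: "\<And>j. j < d \<Longrightarrow> is_matching E (set (g j) - {hd (g j)}) (m j)"
    "\<And>j. j < d \<Longrightarrow> \<Union>(m j) = set (g j) - {hd (g j)}" by metis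
  define W where "W j = {Inr j, Inl (hd (g j))} \<union> Inl ` (set (g j) - {hd (g j)})" for j
  define B where "B j = {{Inr j, Inl (hd (g j))}} \<union> (`) Inl ` m j" for j
  have W: "W j = insert (Inr j) (Inl ` set (g j))" if "j < d" for j
    using hd[OF that] by (auto simp: W_def)
  have UB: "\<Union>(B j) = W j" if "j < d" for j
  proof -
    have "\<Union>((`) Inl ` m j) = (Inl ` \<Union>(m j) :: ('a + nat) set)" by blast
    then show ?thesis using m(2)[OF that] by (simp add: B_def W_def)
  qed
  have "is_matching (aug_edges E d A) (W j) (B j)" if "j < d" for j
    unfolding W_def B_def
  proof (rule is_matching_Un)
    have "{Inr j, Inl (hd (g j))} \<in> aug_edges E d A"
      using that hd[OF that] by (auto simp: aug_edges_def A_def)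
    then show "is_matching (aug_edges E d A) {Inr j, Inl (hd (g j))} {{Inr j, Inl (hd (g j))}}"
      by (simp add: is_matching_def)
  qed (use m(1)[OF that] in \<open>auto intro: is_matching_image_Inl\<close>)
  moreover have "W j \<inter> W k = {}" if "j < d" "k < d" "j \<noteq> k" for j k
  proof -
    have "g j \<noteq> g k" using g that by (auto simp: bij_betw_def inj_on_def)
    then have "set (g j) \<inter> set (g k) = {}" using CC gC that by blast
    then show ?thesis using that by (auto simp: W)
  qed
  ultimately have "is_matching (aug_edges E d A) (\<Union>j\<in>{..<d}. W j) (\<Union>j\<in>{..<d}. B j)"
    by (intro is_matching_UN) auto
  moreover have "is_matching E (\<Union>M) M" using M by (auto simp: is_matching_def)
  then have "is_matching (aug_edges E d A) (Inl ` \<Union>M) ((`) Inl ` M)"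
    by (rule is_matching_image_Inl)
  moreover have "Inl ` \<Union>M \<inter> (\<Union>j\<in>{..<d}. W j) = {}"
  proof -
    have "Inl ` \<Union>M \<inter> W j = {}" if "j < d" for j
      using CM[OF gC[OF that]] by (auto simp: W[OF that])
    then show ?thesis by blast
  qed
  ultimately have match: "is_matching (aug_edges E d A) (Inl ` \<Union>M \<union> (\<Union>j\<in>{..<d}. W j))
      ((`) Inl ` M \<union> (\<Union>j\<in>{..<d}. B j))" (is "is_matching _ _ ?M'")
    by (intro is_matching_Un)
  have "W j \<subseteq> aug_vertices V d" if "j < d" for j
    using CV[OF gC[OF that]] that by (auto simp: W[OF that] aug_vertices_def)
  moreover have "\<Union>M \<subseteq> V" using M by (auto simp: is_matching_def)
  then have "Inl ` \<Union>M \<subseteq> aug_vertices V d"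
    unfolding aug_vertices_def by (intro le_supI1 image_mono)
  ultimately have "is_matching (aug_edges E d A) (aug_vertices V d) ?M'"
    by (intro is_matching_mono[OF match] Un_least UN_least) auto
  moreover have "\<forall>j<d. A j \<subseteq> V" using CV gC by (auto simp: A_def)
  moreover have "Inl ` (\<Union>M \<union> \<Union>(set ` C)) \<subseteq> \<Union>?M'"
  proof -
    have "(Inl ` \<Union>M :: ('a + nat) set) \<subseteq> \<Union>((`) Inl ` M)" by blast
    moreover have "Inl ` set c \<subseteq> (\<Union>j\<in>{..<d}. \<Union>(B j))" if c: "c \<in> C" for c
    proof -
      obtain j where j: "j < d" "c = g j" using g c by (auto simp: bij_betw_def)
      then have "Inl ` set c \<subseteq> \<Union>(B j)" by (auto simp: UB W)
      then show ?thesis using j by blast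
    qed
    ultimately have "Inl ` \<Union>M \<union> (\<Union>c\<in>C. Inl ` set c) \<subseteq> \<Union>((`) Inl ` M) \<union> (\<Union>j\<in>{..<d}. \<Union>(B j))"
      by (intro Un_mono UN_least)
    moreover have "\<Union>(\<Union>j\<in>{..<d}. B j) = (\<Union>j\<in>{..<d}. \<Union>(B j))" by auto
    then have "\<Union>?M' = \<Union>((`) Inl ` M) \<union> (\<Union>j\<in>{..<d}. \<Union>(B j))" by (simp only: Union_Un_distrib)
    moreover have "(Inl ` (\<Union>M \<union> \<Union>(set ` C)) :: ('a + nat) set) =
        Inl ` \<Union>M \<union> (\<Union>c\<in>C. Inl ` set c)" by (simp only: image_Un image_UN)
    ultimately show ?thesis by (simp only:)
  qed
  ultimately show ?thesis unfolding d_def[symmetric] by (intro exI[of _ A] exI[of _ ?M'] conjI)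
qed

lemma matching_of_original_vertices:
  fixes E :: "'a set set"
  assumes "is_matching (aug_edges E d A) (\<Union>i\<in>P. Inl ` Vs i) M"
  shows "\<exists>M'. is_matching E (\<Union>i\<in>P. Vs i) M' \<and> (\<forall>U. util (Inl ` U) M = util U M')"
proof -
  define M' where "M' = {e \<in> E. Inl ` e \<in> M}"
  have M: "M \<subseteq> aug_edges E d A" "\<And>e. e \<in> M \<Longrightarrow> e \<subseteq> (\<Union>i\<in>P. Inl ` Vs i)"
    and disj: "\<And>e f. e \<in> M \<Longrightarrow> f \<in> M \<Longrightarrow> e \<noteq> f \<Longrightarrow> e \<inter> f = {}"
    using assms by (auto simp: is_matching_def)
  have orig: "\<exists>e'\<in>M'. e = Inl ` e'" if "e \<in> M" for e
  proof -
    have "e \<in> aug_edges E d A" "\<forall>j. Inr j \<notin> e" using M that by auto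
    then show ?thesis using that by (auto simp: aug_edges_def M'_def)
  qed
  have "is_matching E (\<Union>i\<in>P. Vs i) M'"
    unfolding is_matching_def
  proof (intro conjI ballI impI)
    show "M' \<subseteq> E" by (auto simp: M'_def)
    show "e \<subseteq> (\<Union>i\<in>P. Vs i)" if "e \<in> M'" for e
      using M(2)[of "Inl ` e"] that by (auto simp: M'_def)
    show "e \<inter> f = {}" if "e \<in> M'" "f \<in> M'" "e \<noteq> f" for e f
    proof -
      have "(Inl ` e :: ('a + nat) set) \<noteq> Inl ` f" using that(3) by (simp add: inj_image_eq_iff)
      then have "(Inl ` e :: ('a + nat) set) \<inter> Inl ` f = {}"
        using disj[of "Inl ` e" "Inl ` f"] that by (simp add: M'_def)
      then show ?thesis by blast
    qed
  qed
  moreover have "util (Inl ` U) M = util U M'" for U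
  proof -
    have iff: "(\<exists>e\<in>M. Inl v \<in> e) \<longleftrightarrow> (\<exists>e\<in>M'. v \<in> e)" for v
    proof
      assume "\<exists>e\<in>M. Inl v \<in> e"
      then show "\<exists>e\<in>M'. v \<in> e" using orig by fastforce
    next
      assume "\<exists>e\<in>M'. v \<in> e"
      then show "\<exists>e\<in>M. Inl v \<in> e" by (auto simp: M'_def)
    qed
    have "{v \<in> Inl ` U. \<exists>e\<in>M. v \<in> e} = Inl ` {v \<in> U. \<exists>e\<in>M. Inl v \<in> e}" by blast
    also have "\<dots> = Inl ` {v \<in> U. \<exists>e\<in>M'. v \<in> e}" unfolding iff ..
    finally show ?thesis unfolding util_def by (simp add: card_image)
  qed
  ultimately show ?thesis by metis
qed

section \<open>The supplemented core\<close>

lemma core_and_pareto_of_unblocked: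
  assumes finN: "finite N" and finU: "\<And>i. i \<in> N \<Longrightarrow> finite (Us i)"
    and M0: "is_matching E W M0" and M0u: "\<And>i. i \<in> N \<Longrightarrow> u i \<le> util (Us i) M0"
    and unbl: "\<And>P M'. P \<subseteq> N \<Longrightarrow> P \<noteq> {} \<Longrightarrow> is_matching E (\<Union>i\<in>P. Vs i) M' \<Longrightarrow>
       \<exists>i\<in>P. util (Us i) M' \<le> u i"
  shows "\<exists>M. in_core N Vs Us E W M \<and> pareto_optimal N Us E W M"
proof -
  define good where "good M \<longleftrightarrow> is_matching E W M \<and> (\<forall>i\<in>N. u i \<le> util (Us i) M)" for M
  define f where "f M = (\<Sum>i\<in>N. util (Us i) M)" for M
  have bd: "f M < Suc (\<Sum>i\<in>N. card (Us i))" for M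
    unfolding f_def util_def less_Suc_eq_le by (intro sum_mono card_mono finU) auto
  have "good M0" using M0 M0u by (auto simp: good_def)
  then obtain M where M: "good M" "\<And>M'. good M' \<Longrightarrow> f M' \<le> f M"
    using ex_has_greatest_nat[of good M0 f] bd by blast
  have "in_core N Vs Us E W M"
    unfolding in_core_def blocks_def
  proof (intro conjI allI notI)
    show "is_matching E W M" using M by (simp add: good_def)
    fix P assume "P \<noteq> {} \<and> P \<subseteq> N \<and> (\<exists>M'. is_matching E (\<Union>i\<in>P. Vs i) M' \<and>
      (\<forall>i\<in>P. util (Us i) M < util (Us i) M'))"
    then obtain M' where "P \<noteq> {}" "P \<subseteq> N" "is_matching E (\<Union>i\<in>P. Vs i) M'"
      "\<forall>i\<in>P. util (Us i) M < util (Us i) M'" by blast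
    then obtain i where "i \<in> P" "util (Us i) M' \<le> u i" using unbl by blast
    moreover have "u i \<le> util (Us i) M" using \<open>i \<in> P\<close> \<open>P \<subseteq> N\<close> M by (auto simp: good_def)
    ultimately show False
      using \<open>\<forall>i\<in>P. util (Us i) M < util (Us i) M'\<close> by (meson linorder_not_less order_trans)
  qed
  moreover have "pareto_optimal N Us E W M"
    unfolding pareto_optimal_def
  proof (intro conjI notI)
    show "is_matching E W M" using M by (simp add: good_def)
    assume "\<exists>M'. is_matching E W M' \<and> (\<forall>i\<in>N. util (Us i) M' \<ge> util (Us i) M) \<and>
            (\<exists>i\<in>N. util (Us i) M' > util (Us i) M)"
    then obtain M' where M': "is_matching E W M'" "\<forall>i\<in>N. util (Us i) M' \<ge> util (Us i) M"
      "\<exists>i\<in>N. util (Us i) M' > util (Us i) M" by blast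
    have "good M'" using M M' by (auto simp: good_def intro: order_trans)
    moreover have "f M < f M'" unfolding f_def using M' finN by (intro sum_strict_mono_ex1) auto
    ultimately show False using M(2) by (simp add: leD)
  qed
  ultimately show ?thesis by blast
qed

lemma matching_covered_le_neighbours:
  assumes M: "is_matching E W M" and fin: "finite W"
    and pair: "\<And>e. e \<in> E \<Longrightarrow> \<exists>x y. e = {x, y} \<and> x \<noteq> y"
  shows "card (X \<inter> \<Union>M) \<le> card ({w. \<exists>v\<in>X. {v, w} \<in> E} \<inter> W)"
proof -
  have "\<exists>w. {v, w} \<in> M" if v: "v \<in> X \<inter> \<Union>M" for v
  proof -
    obtain e where e: "e \<in> M" "v \<in> e" using v by blast
    then obtain x y where "e = {x, y}" using pair[of e] M by (auto simp: is_matching_def)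
    then show ?thesis using e by (metis empty_iff insert_commute insert_iff)
  qed
  then obtain m where m: "\<And>v. v \<in> X \<inter> \<Union>M \<Longrightarrow> {v, m v} \<in> M" by metis
  have mE: "{v, m v} \<in> E" "{v, m v} \<subseteq> W" if "v \<in> X \<inter> \<Union>M" for v
    using m[OF that] M by (auto simp: is_matching_def)
  show ?thesis
  proof (rule card_inj_on_le)
    show "m ` (X \<inter> \<Union>M) \<subseteq> {w. \<exists>v\<in>X. {v, w} \<in> E} \<inter> W"
      using mE by blast
    show "inj_on m (X \<inter> \<Union>M)"
    proof (rule inj_onI)
      fix v v' assume v: "v \<in> X \<inter> \<Union>M" "v' \<in> X \<inter> \<Union>M" "m v = m v'"
      have "{v, m v} \<inter> {v', m v'} \<noteq> {}" using v(3) by simp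
      moreover have "{v, m v} \<noteq> {v', m v'} \<longrightarrow> {v, m v} \<inter> {v', m v'} = {}"
        using is_matching_disjoint[OF M m[OF v(1)] m[OF v(2)]] by (rule impI)
      ultimately have "{v, m v} = {v', m v'}" by metis
      then show "v = v'" using v(3) by (auto simp: doubleton_eq_iff)
    qed
  qed (use fin in simp)
qed

lemma unblocked_utilities_by_injection:
  fixes N :: "'i set" and Vs Us :: "'i \<Rightarrow> 'v set" and E :: "'v set set"
  assumes finN: "finite N" and finV: "\<And>i. i \<in> N \<Longrightarrow> finite (Vs i)"
    and disjV: "\<And>i j. i \<in> N \<Longrightarrow> j \<in> N \<Longrightarrow> i \<noteq> j \<Longrightarrow> Vs i \<inter> Vs j = {}"
    and UV: "\<And>i. i \<in> N \<Longrightarrow> Us i \<subseteq> Vs i"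
    and pair: "\<And>e. e \<in> E \<Longrightarrow> \<exists>x y. e = {x, y} \<and> x \<noteq> y" and EV: "\<Union>E \<subseteq> (\<Union>i\<in>N. Vs i)"
  obtains u :: "'i \<Rightarrow> nat" and S :: "'v set" and \<pi> :: "'v \<Rightarrow> 'v" where
    "\<And>P M. P \<subseteq> N \<Longrightarrow> P \<noteq> {} \<Longrightarrow> is_matching E (\<Union>i\<in>P. Vs i) M \<Longrightarrow> \<exists>i\<in>P. util (Us i) M \<le> u i"
    "finite S" "inj_on \<pi> S" "\<And>v. v \<in> S \<Longrightarrow> {v, \<pi> v} \<in> E"
    "\<And>i. i \<in> N \<Longrightarrow> u i \<le> card (S \<inter> Us i)"
proof -
  define V where "V = (\<Union>i\<in>N. Vs i)"
  define k where "k = card V"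
  have "finite V" using finN finV by (auto simp: V_def)
  have finU: "finite (Us i)" if "i \<in> N" for i using finV UV that finite_subset by blast
  have disjU: "Us i \<inter> Us j = {}" if "i \<in> N" "j \<in> N" "i \<noteq> j" for i j
    using disjV[OF that] UV[OF that(1)] UV[OF that(2)] by blast
  have card_V: "card Z \<le> k" if "Z \<subseteq> V" for Z
    unfolding k_def using that \<open>finite V\<close> by (rule card_mono[rotated])
  have UsV: "Us i \<subseteq> V" if "i \<in> N" for i using UV[OF that] that by (auto simp: V_def)
  have util_le: "util (Us i) M \<le> card (Us i)" if "i \<in> N" for i M
    unfolding util_def using finU[OF that] by (intro card_mono) auto
  define R where "R P = {\<lambda>i. util (Us i) M | M. is_matching E (\<Union>i\<in>P. Vs i) M}" for P
  obtain u where u: "\<And>P r. P \<subseteq> N \<Longrightarrow> P \<noteq> {} \<Longrightarrow> r \<in> R P \<Longrightarrow> \<exists>i\<in>P. r i \<le> u i"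
    and dual: "\<And>y :: 'i \<Rightarrow> int. (\<And>i. i \<in> N \<Longrightarrow> \<bar>y i\<bar> \<le> int (2 * k + 1)) \<Longrightarrow>
       (\<And>P r. P \<subseteq> N \<Longrightarrow> r \<in> R P \<Longrightarrow> \<forall>i\<in>P. u i \<le> r i \<Longrightarrow> 0 \<le> sum y P) \<Longrightarrow> 0 \<le> sum y N"
  proof (rule dual_core_exists[OF finN, of R k "2 * k + 1"])
    show "R P \<noteq> {}" for P
      unfolding R_def by (auto simp: is_matching_def intro!: exI[of _ "{}"])
    show "r i \<le> k" if "P \<subseteq> N" "r \<in> R P" "i \<in> P" for P r i
    proof -
      have i: "i \<in> N" using that by blast
      obtain M where "r = (\<lambda>i. util (Us i) M)" using \<open>r \<in> R P\<close> by (auto simp: R_def)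
      then show ?thesis using util_le[OF i, of M] card_V[OF UsV[OF i]] by simp
    qed
  qed blast
  have uU: "u i \<le> card (Us i)" if i: "i \<in> N" for i
  proof (rule ccontr)
    assume *: "\<not> u i \<le> card (Us i)"
    have "0 \<le> (\<Sum>j\<in>N. - of_bool (j = i) :: int)"
    proof (rule dual)
      fix P r assume P: "P \<subseteq> N" "r \<in> R P" "\<forall>j\<in>P. u j \<le> r j"
      obtain M where "r = (\<lambda>i. util (Us i) M)" using \<open>r \<in> R P\<close> by (auto simp: R_def)
      then have "\<not> u i \<le> r i" using * util_le[OF i, of M] by simp
      then have "i \<notin> P" using P(3) by blast
      then have "(\<Sum>j\<in>P. - of_bool (j = i) :: int) = 0" by (intro sum.neutral) auto
      then show "0 \<le> (\<Sum>j\<in>P. - of_bool (j = i) :: int)" by simp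
    qed auto
    then show False using i finN by (simp add: sum_negf of_bool_def)
  qed
  define \<Gamma> :: "'v \<Rightarrow> ('v + 'i \<times> nat) set" where
    "\<Gamma> v = Inl ` {w. {v, w} \<in> E} \<union> Inr ` (SIGMA i : {i \<in> N. v \<in> Us i}. {..<card (Us i) - u i})" for v
  define A where "A = (\<Union>i\<in>N. Us i)"
  have "finite A" using finN finU by (auto simp: A_def)
  have nbV: "{w. \<exists>v\<in>X. {v, w} \<in> E} \<subseteq> V" for X using EV by (auto simp: V_def)
  have "\<exists>f. inj_on f A \<and> (\<forall>v\<in>A. f v \<in> \<Gamma> v)"
  proof (rule hall_marriage[OF \<open>finite A\<close>])
    show "finite (\<Gamma> v)" for v
      using finite_subset[OF nbV[of "{v}"] \<open>finite V\<close>] finN by (simp add: \<Gamma>_def)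
    fix X assume X: "X \<subseteq> A"
    define NX where "NX = {w. \<exists>v\<in>X. {v, w} \<in> E}"
    have NX: "NX \<subseteq> V" "finite NX" using nbV finite_subset[OF nbV \<open>finite V\<close>] by (auto simp: NX_def)
    define T where "T = {i \<in> N. X \<inter> Us i \<noteq> {}}"
    have T: "T \<subseteq> N" "finite T" using finN by (auto simp: T_def)
    define a :: "'i \<Rightarrow> int" where
      "a i = (if i \<in> T then int (card (X \<inter> Us i)) - int (card (Us i) - u i) else 0)" for i
    define y :: "'i \<Rightarrow> int" where "y i = int (card (NX \<inter> Vs i)) - a i" for i
    have "0 \<le> sum y N"
    proof (rule dual)
      fix i assume i: "i \<in> N"
      have "card (NX \<inter> Vs i) \<le> k" "card (X \<inter> Us i) \<le> k" "card (Us i) \<le> k"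
        using NX UsV[OF i] by (auto intro!: card_V)
      then show "\<bar>y i\<bar> \<le> int (2 * k + 1)" by (auto simp: y_def a_def)
    next
      fix P r assume P: "P \<subseteq> N" "r \<in> R P" "\<forall>i\<in>P. u i \<le> r i"
      then obtain M where M: "is_matching E (\<Union>i\<in>P. Vs i) M" "\<forall>i\<in>P. u i \<le> util (Us i) M"
        by (auto simp: R_def)
      have "finite P" using P finN finite_subset by blast
      have a_le: "a i \<le> int (card (X \<inter> Us i \<inter> \<Union>M))" if "i \<in> P" for i
      proof (cases "i \<in> T")
        case True
        have i: "i \<in> N" using that P by blast
        have "u i \<le> card (Us i \<inter> \<Union>M)"
          using M(2) that by (auto simp: util_def Int_def)
        also have "\<dots> \<le> card ((X \<inter> Us i \<inter> \<Union>M) \<union> (Us i - X))"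
          using finU[OF i] by (intro card_mono) auto
        also have "\<dots> \<le> card (X \<inter> Us i \<inter> \<Union>M) + card (Us i - X)" by (rule card_Un_le)
        also have "card (Us i - X) = card (Us i) - card (X \<inter> Us i)"
          using finU[OF i] by (simp add: card_Diff_subset_Int Int_commute)
        finally have "u i \<le> card (X \<inter> Us i \<inter> \<Union>M) + (card (Us i) - card (X \<inter> Us i))" .
        moreover have "card (X \<inter> Us i) \<le> card (Us i)" using finU[OF i] by (intro card_mono) auto
        ultimately show ?thesis using True uU[OF i] by (simp add: a_def)
      qed (simp add: a_def)
      have "sum a P \<le> (\<Sum>i\<in>P. int (card (X \<inter> Us i \<inter> \<Union>M)))" by (intro sum_mono a_le)
      also have "\<dots> = int (card (\<Union>i\<in>P. X \<inter> Us i \<inter> \<Union>M))"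
        using \<open>finite P\<close> P finU disjU by (subst card_UN_disjoint) (auto, blast)
      also have "(\<Union>i\<in>P. X \<inter> Us i \<inter> \<Union>M) = (X \<inter> (\<Union>i\<in>P. Us i)) \<inter> \<Union>M" by blast
      also have "int (card \<dots>) \<le> int (card ({w. \<exists>v\<in>X \<inter> (\<Union>i\<in>P. Us i). {v, w} \<in> E} \<inter> (\<Union>i\<in>P. Vs i)))"
        using matching_covered_le_neighbours[OF M(1) _ pair] \<open>finite P\<close> finV P by auto
      also have "\<dots> \<le> int (card (\<Union>i\<in>P. NX \<inter> Vs i))"
        using NX \<open>finite P\<close> unfolding of_nat_le_iff by (intro card_mono) (auto simp: NX_def)
      also have "\<dots> = (\<Sum>i\<in>P. int (card (NX \<inter> Vs i)))"
        using \<open>finite P\<close> P NX(2) disjV by (subst card_UN_disjoint) (auto, blast)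
      finally show "0 \<le> sum y P" by (simp add: y_def sum_subtractf)
    qed
    have "X = (\<Union>i\<in>T. X \<inter> Us i)" using X unfolding A_def T_def by blast
    then have "card X = (\<Sum>i\<in>T. card (X \<inter> Us i))"
      using T finU disjU by (subst card_UN_disjoint[symmetric]) (auto, blast)
    then have "int (card X) = (\<Sum>i\<in>T. a i) + (\<Sum>i\<in>T. int (card (Us i) - u i))"
      by (simp add: a_def flip: sum.distrib)
    also have "(\<Sum>i\<in>T. a i) = sum a N"
      using T finN by (intro sum.mono_neutral_left) (auto simp: a_def)
    also have "\<dots> \<le> (\<Sum>i\<in>N. int (card (NX \<inter> Vs i)))"
      using \<open>0 \<le> sum y N\<close> by (simp add: y_def sum_subtractf)
    also have "\<dots> = int (card (\<Union>i\<in>N. NX \<inter> Vs i))"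
      using finN NX(2) disjV by (subst card_UN_disjoint) auto
    also have "(\<Union>i\<in>N. NX \<inter> Vs i) = NX" using NX(1) by (auto simp: V_def)
    finally have "card X \<le> card NX + (\<Sum>i\<in>T. card (Us i) - u i)"
      by (simp flip: of_nat_sum of_nat_add)
    also have "\<dots> = card (Inl ` NX \<union> Inr ` (SIGMA i : T. {..<card (Us i) - u i})
        :: ('v + 'i \<times> nat) set)"
      using NX(2) T(2) by (subst card_Un_disjoint) (auto simp: card_image card_SigmaI)
    also have "Inl ` NX \<union> Inr ` (SIGMA i : T. {..<card (Us i) - u i}) = \<Union>(\<Gamma> ` X)"
      unfolding \<Gamma>_def NX_def T_def by blast
    finally show "card X \<le> card (\<Union>(\<Gamma> ` X))" .
  qed
  then obtain f where f: "inj_on f A" "\<And>v. v \<in> A \<Longrightarrow> f v \<in> \<Gamma> v" by blast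
  define S where "S = {v \<in> A. isl (f v)}"
  show ?thesis
  proof (rule that[of u S "projl \<circ> f"])
    show "\<exists>i\<in>P. util (Us i) M \<le> u i"
      if "P \<subseteq> N" "P \<noteq> {}" "is_matching E (\<Union>i\<in>P. Vs i) M" for P M
      using u[OF that(1,2), of "\<lambda>i. util (Us i) M"] that(3) by (auto simp: R_def)
    show "finite S" using \<open>finite A\<close> by (simp add: S_def)
    show "inj_on (projl \<circ> f) S"
      using f(1) unfolding S_def inj_on_def by (auto simp: isl_def)
    show "{v, (projl \<circ> f) v} \<in> E" if "v \<in> S" for v
      using f(2)[of v] that by (auto simp: S_def \<Gamma>_def)
    fix i assume i: "i \<in> N"
    have "card (Us i - S) \<le> card (Inr ` ({i} \<times> {..<card (Us i) - u i}) :: ('v + 'i \<times> nat) set)"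
    proof (rule card_inj_on_le)
      have sub: "Us i - S \<subseteq> A" using i by (auto simp: A_def)
      show "inj_on f (Us i - S)" using f(1) sub by (rule inj_on_subset)
      show "f ` (Us i - S) \<subseteq> Inr ` ({i} \<times> {..<card (Us i) - u i})"
      proof (rule image_subsetI)
        fix v assume v: "v \<in> Us i - S"
        then have "\<not> isl (f v)" using sub by (auto simp: S_def)
        then obtain j n where jn: "f v = Inr (j, n)" by (cases "f v") auto
        then have "j \<in> N" "v \<in> Us j" "n < card (Us j) - u j" using f(2)[of v] v sub by (auto simp: \<Gamma>_def)
        moreover have "j = i" using disjU[OF i \<open>j \<in> N\<close>] v \<open>v \<in> Us j\<close> by blast
        ultimately show "f v \<in> Inr ` ({i} \<times> {..<card (Us i) - u i})" using jn by simp
      qed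
    qed simp
    also have "\<dots> = card (Us i) - u i" by (simp add: card_image)
    finally have "card (Us i - S) \<le> card (Us i) - u i" .
    moreover have "card (Us i) = card (Us i - S) + card (S \<inter> Us i)"
      using finU[OF i] card_Diff_subset_Int[of "Us i" S] card_mono[OF finU[OF i], of "Us i \<inter> S"]
      by (simp add: Int_commute)
    ultimately show "u i \<le> card (S \<inter> Us i)" using uU[OF i] by linarith
  qed
qed

theorem mainTheorem5:
  fixes N :: "'i set" and Vs Us :: "'i \<Rightarrow> 'v set" and E :: "'v set set"
  assumes "finite N"
    and "\<forall>i\<in>N. finite (Vs i)"
    and "\<forall>i\<in>N. \<forall>j\<in>N. i \<noteq> j \<longrightarrow> Vs i \<inter> Vs j = {}"
    and "\<forall>i\<in>N. Us i \<subseteq> Vs i"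
    and "\<forall>e\<in>E. \<exists>x y. e = {x, y} \<and> x \<noteq> y \<and> x \<in> (\<Union>i\<in>N. Vs i) \<and> y \<in> (\<Union>i\<in>N. Vs i)"
  shows "(\<exists>d A M. d \<le> nu E \<and> (\<forall>j<d. A j \<subseteq> (\<Union>i\<in>N. Vs i)) \<and>
            in_core N (\<lambda>i. Inl ` Vs i) (\<lambda>i. Inl ` Us i) (aug_edges E d A)
               (aug_vertices (\<Union>i\<in>N. Vs i) d) M \<and>
            pareto_optimal N (\<lambda>i. Inl ` Us i) (aug_edges E d A)
               (aug_vertices (\<Union>i\<in>N. Vs i) d) M)
       \<and> (bipartite E \<longrightarrow>
            (\<exists>M. in_core N Vs Us E (\<Union>i\<in>N. Vs i) M \<and>
                 pareto_optimal N Us E (\<Union>i\<in>N. Vs i) M))"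
proof -
  define V where "V = (\<Union>i\<in>N. Vs i)"
  have EV: "\<Union>E \<subseteq> V" using assms(5) by (fastforce simp: V_def)
  have "finite V" using assms(1,2) by (simp add: V_def)
  have finU: "finite (Us i)" if "i \<in> N" for i using assms(2,4) that finite_subset by blast
  have pair: "\<exists>x y. e = {x, y} \<and> x \<noteq> y" if "e \<in> E" for e using assms(5) that by blast
  obtain u S \<pi> where u: "\<And>P M. P \<subseteq> N \<Longrightarrow> P \<noteq> {} \<Longrightarrow> is_matching E (\<Union>i\<in>P. Vs i) M \<Longrightarrow>
        \<exists>i\<in>P. util (Us i) M \<le> u i"
    and S: "finite S" "inj_on \<pi> S" "\<And>v. v \<in> S \<Longrightarrow> {v, \<pi> v} \<in> E"
    and uS: "\<And>i. i \<in> N \<Longrightarrow> u i \<le> card (S \<inter> Us i)"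
  proof (rule unblocked_utilities_by_injection[of N Vs Us E])
    show "\<Union>E \<subseteq> (\<Union>i\<in>N. Vs i)" using EV by (simp add: V_def)
  qed ((rule that; assumption) | (use assms(1-4) pair in simp))+
  have "{v} \<notin> E" for v using pair[of "{v}"] by (auto simp: doubleton_eq_iff)
  then obtain M1 C1 where "cycle_packing E (S \<union> \<pi> ` S) M1 C1" "S \<subseteq> \<Union>M1 \<union> \<Union>(set ` C1)"
    using cycle_packing_of_injection[OF S] by metis
  then obtain M0 C where pack: "cycle_packing E (S \<union> \<pi> ` S) M0 C"
    and cover: "S \<subseteq> \<Union>M0 \<union> \<Union>(set ` C)" and indep: "indep_odd_cycles E C"
    using independent_cycle_packing_exists by metis
  have "S \<union> \<pi> ` S \<subseteq> V" using S(3) EV by fast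
  then have pack: "cycle_packing E V M0 C" using pack by (rule cycle_packing_mono[rotated])
  have "\<exists>d A M. d \<le> nu E \<and> (\<forall>j<d. A j \<subseteq> V) \<and>
      in_core N (\<lambda>i. Inl ` Vs i) (\<lambda>i. Inl ` Us i) (aug_edges E d A) (aug_vertices V d) M \<and>
      pareto_optimal N (\<lambda>i. Inl ` Us i) (aug_edges E d A) (aug_vertices V d) M"
  proof -
    define d where "d = card C"
    have "d \<le> nu E"
      unfolding d_def using finite_subset[OF EV \<open>finite V\<close>] indep by (rule card_indep_odd_cycles_le_nu)
    obtain A M' where A: "\<forall>j<d. A j \<subseteq> V"
      and M': "is_matching (aug_edges E d A) (aug_vertices V d) M'"
      and M'_cover: "Inl ` (\<Union>M0 \<union> \<Union>(set ` C)) \<subseteq> \<Union>M'"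
      using donors_cover_cycle_packing[OF pack] unfolding d_def by metis
    have "\<exists>M. in_core N (\<lambda>i. Inl ` Vs i) (\<lambda>i. Inl ` Us i) (aug_edges E d A) (aug_vertices V d) M \<and>
      pareto_optimal N (\<lambda>i. Inl ` Us i) (aug_edges E d A) (aug_vertices V d) M"
    proof (rule core_and_pareto_of_unblocked[where u = u, OF assms(1) _ M'])
      show "finite (Inl ` Us i)" if "i \<in> N" for i using finU[OF that] by simp
      show "u i \<le> util (Inl ` Us i) M'" if i: "i \<in> N" for i
      proof -
        have "card (S \<inter> Us i) = card (Inl ` S \<inter> Inl ` Us i :: ('v + nat) set)"
          by (simp add: card_image flip: image_Int)
        also have "\<dots> \<le> util (Inl ` Us i) M'"
          using finU[OF i] cover M'_cover by (intro card_le_util) blast+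
        finally show ?thesis using uS[OF i] by simp
      qed
      show "\<exists>i\<in>P. util (Inl ` Us i) M \<le> u i"
        if "P \<subseteq> N" "P \<noteq> {}" "is_matching (aug_edges E d A) (\<Union>i\<in>P. Inl ` Vs i) M" for P M
        using matching_of_original_vertices[OF that(3)] u[OF that(1,2)] by metis
    qed
    then show ?thesis using \<open>d \<le> nu E\<close> A by blast
  qed
  moreover have "\<exists>M. in_core N Vs Us E V M \<and> pareto_optimal N Us E V M" if "bipartite E"
  proof (rule core_and_pareto_of_unblocked[where u = u, OF assms(1) finU _ _ u])
    have "C = {}" using indep bipartite_no_odd_cycle[OF that] by (auto simp: indep_odd_cycles_def)
    then show "u i \<le> util (Us i) M0" if "i \<in> N" for i
      using uS[OF that] card_le_util[OF finU[OF that], of S M0] cover by fastforce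
    show "is_matching E V M0" using pack by (simp add: cycle_packing_def)
  qed
  ultimately show ?thesis unfolding V_def by metis
qed

end
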